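(* For every $P\subseteq[0,1]^n$ and every integer $k\ge1$, $\mathrm{SA}^{k+1}(P)\subseteq\mathrm{SA}'^{k}(P)$.
   Context: **Notation.** Let $[n]=\{1,\dots,n\}$, $\mathcal F=\{0,1\}^n$. For $P\subseteq[0,1]^n$ let $K(P)=\{(\lambda,\lambda x)\in\mathbb R^{n+1}:\lambda\ge 0,\ x\in P\}$. For $S\subseteq[n]$, $t\in\{0,1\}$, let $S|_t=\{x\in\mathcal F: x_i=t\ \forall i\in S\}$ (so $\emptyset|_t=\mathcal F$) and $i|_t=\{i\}|_t$. For $k\ge0$ let $\mathcal A_k=\{S|_1\cap T|_0:S,T\subseteq[n],\ S\cap T=\emptyset,\ |S|+|T|\le k\}$ and $\mathcal A_k^+=\{S|_1:S\subseteq[n],|S|\le k\}$. Matrices have rows and columns indexed by families of subsets of $\mathcal F$; $Ye_\alpha$ is the column of $Y$ indexed by $\alpha$. For $x\in\mathbb R^n$, $\hat x=(1,x)\in\mathbb R^{n+1}$. Vectors indexed by $\mathcal A_1^+$ are identified with vectors in $\mathbb R^{n+1}$ via the order $\mathcal F,1|_1,\dots,n|_1$. **The operators $\mathrm{SA}^k$ and $\mathrm{SA}'^k$ ($k\ge1$).** Let $\tilde{\mathrm{SA}}^k(P)$ be the set of matrices $Y\in\mathbb R^{\mathcal A_1^+\times\mathcal A_k}$ such that: (1) $Y[\mathcal F,\mathcal F]=1$; (2) $Ye_\alpha\in K(P)$ for all $\alpha\in\mathcal A_k$; (3) for every $S|_1\cap T|_0\in\mathcal A_{k-1}$ and $j\in[n]\setminus(S\cup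 T)$: $Ye_{S|_1\cap T|_0\cap j|_1}+Ye_{S|_1\cap T|_0\cap j|_0}=Ye_{S|_1\cap T|_0}$; (4) $Y[\alpha,\beta]=0$ for all $\alpha\in\mathcal A_1^+,\beta\in\mathcal A_k$ with $\alpha\cap\beta=\emptyset$; (5) $Y[\alpha_1,\beta_1]=Y[\alpha_2,\beta_2]$ for all $\alpha_1,\alpha_2\in\mathcal A_1^+$, $\beta_1,\beta_2\in\mathcal A_k$ with $\alpha_1\cap\beta_1=\alpha_2\cap\beta_2$. Let $\tilde{\mathrm{SA}}'^k(P)$ be the set of $Y\in\tilde{\mathrm{SA}}^k(P)$ that also satisfy (4') $Y[\alpha,\beta]=0$ for all $\alpha\in\mathcal A_1^+,\beta\in\mathcal A_k$ with $\mathrm{conv}(\alpha)\cap\mathrm{conv}(\beta)\cap P=\emptyset$. Then $\mathrm{SA}^k(P)=\{x\in\mathbb R^n:\exists Y\in\tilde{\mathrm{SA}}^k(P),\ Ye_{\mathcal F}=\hat x\}$ and $\mathrm{SA}'^k(P)=\{x\in\mathbb R^n:\exists Y\in\tilde{\mathrm{SA}}'^k(P),\ Ye_{\mathcal F}=\hat x\}$. *)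

theory Defs
  imports "HOL-Analysis.Analysis"
begin

(* The ground set [n] is the finite index type 'n, and R^(n+1) is rendered as
   real \<times> (real^'n), the first factor being the homogenizing coordinate. *)

definition binaries :: "(real^'n) set" where
  "binaries = {x. \<forall>i. x $ i \<in> {0, 1}}"

definition cone_of :: "(real^'n) set \<Rightarrow> (real \<times> (real^'n)) set" where
  "cone_of P = {(c, c *\<^sub>R x) | c x. c \<ge> 0 \<and> x \<in> P}"

definition fixed :: "'n set \<Rightarrow> real \<Rightarrow> (real^'n) set" (infix "|||" 75) where
  "S ||| t = {x \<in> binaries. \<forall>i\<in>S. x $ i = t}"

definition faces :: "nat \<Rightarrow> (real^'n) set set" where
  "faces k = {(S ||| 1) \<inter> (T ||| 0) | S T. S \<inter> T = {} \<and> card S + card T \<le> k}"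

definition faces_pos :: "nat \<Rightarrow> (real^'n) set set" where
  "faces_pos k = {S ||| 1 | S. card S \<le> k}"

type_synonym 'n lift_matrix = "(real^'n) set \<times> (real^'n) set \<Rightarrow> real"

(* The column of Y indexed by \<beta>, its rows taken in the order F, 1|_1, ..., n|_1. *)
definition col :: "'n lift_matrix \<Rightarrow> (real^'n) set \<Rightarrow> real \<times> (real^'n)" where
  "col Y \<beta> = (Y (binaries, \<beta>), \<chi> i. Y ({i} ||| 1, \<beta>))"

(* Only meaningful for k \<ge> 1. Matrices are functions that are undefined outside
   the index set, so that this is literally a set of arrays over that set. *)
definition SA_lift :: "nat \<Rightarrow> (real^'n) set \<Rightarrow> 'n lift_matrix set" where
  "SA_lift k P = {Y \<in> (faces_pos 1 \<times> faces k) \<rightarrow>\<^sub>E UNIV.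
     Y (binaries, binaries) = 1 \<and>
     (\<forall>\<alpha>\<in>faces k. col Y \<alpha> \<in> cone_of P) \<and>
     (\<forall>S T. (S ||| 1) \<inter> (T ||| 0) \<in> faces (k - 1) \<longrightarrow>
        (\<forall>j\<in>- (S \<union> T).
           col Y ((S ||| 1) \<inter> (T ||| 0) \<inter> ({j} ||| 1)) +
           col Y ((S ||| 1) \<inter> (T ||| 0) \<inter> ({j} ||| 0)) =
           col Y ((S ||| 1) \<inter> (T ||| 0)))) \<and>
     (\<forall>\<alpha>\<in>faces_pos 1. \<forall>\<beta>\<in>faces k. \<alpha> \<inter> \<beta> = {} \<longrightarrow> Y (\<alpha>, \<beta>) = 0) \<and>
     (\<forall>\<alpha>\<^sub>1\<in>faces_pos 1. \<forall>\<alpha>\<^sub>2\<in>faces_pos 1. \<forall>\<beta>\<^sub>1\<in>faces k. \<forall>\<beta>\<^sub>2\<in>faces k.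
        \<alpha>\<^sub>1 \<inter> \<beta>\<^sub>1 = \<alpha>\<^sub>2 \<inter> \<beta>\<^sub>2 \<longrightarrow> Y (\<alpha>\<^sub>1, \<beta>\<^sub>1) = Y (\<alpha>\<^sub>2, \<beta>\<^sub>2))}"

definition SA'_lift :: "nat \<Rightarrow> (real^'n) set \<Rightarrow> 'n lift_matrix set" where
  "SA'_lift k P = {Y \<in> SA_lift k P.
     \<forall>\<alpha>\<in>faces_pos 1. \<forall>\<beta>\<in>faces k.
       convex hull \<alpha> \<inter> convex hull \<beta> \<inter> P = {} \<longrightarrow> Y (\<alpha>, \<beta>) = 0}"

definition SA :: "nat \<Rightarrow> (real^'n) set \<Rightarrow> (real^'n) set" where
  "SA k P = {x. \<exists>Y\<in>SA_lift k P. col Y binaries = (1, x)}"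

definition SA' :: "nat \<Rightarrow> (real^'n) set \<Rightarrow> (real^'n) set" where
  "SA' k P = {x. \<exists>Y\<in>SA'_lift k P. col Y binaries = (1, x)}"

end

theory Submission
  imports Defs
begin

text \<open>
  Restricting a matrix \<open>Y\<close> from level \<open>k + 1\<close> to the columns of level \<open>k\<close> gives the required
  certificate. For (4'), suppose \<open>Y[\<alpha>, \<beta>] \<noteq> 0\<close>. By (4) the set \<open>\<gamma> = \<alpha> \<inter> \<beta>\<close> is nonempty, hence
  a face of level \<open>k + 1\<close>, and (5) gives \<open>Y[F, \<gamma>] = Y[\<alpha>, \<beta>]\<close>. Normalising the column of
  \<open>\<gamma>\<close> yields a point of \<open>P\<close> whose coordinates fixed by \<open>\<gamma>\<close> have, by (4) and (5), the prescribed
  values; this point therefore lies in \<open>conv \<gamma> \<subseteq> conv \<alpha> \<inter> conv \<beta>\<close>.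
\<close>

lemma fixed_empty [simp]: "({} ||| t) = binaries"
  by (auto simp: fixed_def)

lemma fixed_subset_binaries: "S ||| t \<subseteq> binaries"
  by (auto simp: fixed_def)

lemma fixed_Int: "(S ||| t) \<inter> (T ||| t) = (S \<union> T) ||| t"
  by (auto simp: fixed_def)

lemma facesI:
  "S \<inter> T = {} \<Longrightarrow> card S + card T \<le> k \<Longrightarrow> (S ||| 1) \<inter> (T ||| 0) \<in> faces k"
  by (auto simp: faces_def)

lemma binaries_in_faces: "binaries \<in> faces k"
  using facesI[of "{}" "{}" k] by simp

lemma binaries_in_faces_pos: "binaries \<in> faces_pos k"
  unfolding faces_pos_def by (auto intro: exI[of _ "{}"])

lemma singleton_in_faces_pos: "{i} ||| 1 \<in> faces_pos 1"
  by (auto simp: faces_pos_def)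

lemma faces_mono: "j \<le> k \<Longrightarrow> faces j \<subseteq> faces k"
  unfolding faces_def by fastforce

lemma face_subset_binaries: "\<beta> \<in> faces k \<Longrightarrow> \<beta> \<subseteq> binaries"
  by (auto simp: faces_def fixed_def)

text \<open>Disjointness of \<open>S'\<close> and \<open>T'\<close> makes the face nonempty, and a
  nonempty face determines which coordinates are constant on it and with which value. Condition (3)
  of \<open>SA_lift\<close> only says that the set given by \<open>S\<close> and \<open>T\<close> is
  a face; uniqueness turns this into disjointness and a cardinality bound for \<open>S\<close> and
  \<open>T\<close> themselves.\<close>

lemma face_representation_unique:
  fixes S T :: "'n::finite set"
  assumes "S' \<inter> T' = {}" and eq: "(S ||| 1) \<inter> (T ||| 0) = (S' ||| 1) \<inter> (T' ||| 0)"
  shows "S = S'" "T = T'"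
proof -
  \<comment> \<open>\<open>v 0\<close> and \<open>v 1\<close> are the extreme fillings of the free
    coordinates. \<open>v 0\<close> has ones only on \<open>S'\<close>, which forces
    \<open>S \<subseteq> S'\<close>; \<open>v 1\<close> has zeros only on \<open>T'\<close>, which
    forces \<open>T \<subseteq> T'\<close>.\<close>
  define v :: "real \<Rightarrow> real^'n" where
    "v c = (\<chi> i. if i \<in> S' then 1 else if i \<in> T' then 0 else c)" for c
  have "v c \<in> (S' ||| 1) \<inter> (T' ||| 0)" if "c \<in> {0, 1}" for c
    using that assms(1) by (auto simp: v_def fixed_def binaries_def)
  then have "v 0 \<in> (S ||| 1) \<inter> (T ||| 0)" "v 1 \<in> (S ||| 1) \<inter> (T ||| 0)"
    unfolding eq by auto
  then have sub: "S \<subseteq> S'" "T \<subseteq> T'"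
    by (auto simp: fixed_def v_def split: if_splits)
  \<comment> \<open>The same argument in the other direction; the inclusions just obtained make
    \<open>S\<close> and \<open>T\<close> disjoint, so \<open>w c\<close> does lie in the
    face.\<close>
  define w :: "real \<Rightarrow> real^'n" where
    "w c = (\<chi> i. if i \<in> S then 1 else if i \<in> T then 0 else c)" for c
  have "w c \<in> (S ||| 1) \<inter> (T ||| 0)" if "c \<in> {0, 1}" for c
    using that assms(1) sub by (auto simp: w_def fixed_def binaries_def)
  then have "w 0 \<in> (S' ||| 1) \<inter> (T' ||| 0)" "w 1 \<in> (S' ||| 1) \<inter> (T' ||| 0)"
    unfolding eq[symmetric] by auto
  then have "S' \<subseteq> S" "T' \<subseteq> T"
    by (auto simp: fixed_def w_def split: if_splits)
  with sub show "S = S'" "T = T'" by auto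
qed

text \<open>Ensures that the two columns on the left of condition (3) survive the restriction of the
  matrix.\<close>

lemma split_face_in_faces:
  fixes S T :: "'n::finite set"
  assumes "(S ||| 1) \<inter> (T ||| 0) \<in> faces k" and "j \<notin> S \<union> T"
  shows "(S ||| 1) \<inter> (T ||| 0) \<inter> ({j} ||| 1) \<in> faces (Suc k)"
    and "(S ||| 1) \<inter> (T ||| 0) \<inter> ({j} ||| 0) \<in> faces (Suc k)"
proof -
  obtain S' T' where "S' \<inter> T' = {}" "card S' + card T' \<le> k"
    and "(S ||| 1) \<inter> (T ||| 0) = (S' ||| 1) \<inter> (T' ||| 0)"
    using assms(1) by (auto simp: faces_def)
  with face_representation_unique[of S' T' S T]
  have ST: "S \<inter> T = {}" "card S + card T \<le> k" by auto
  have "(S ||| 1) \<inter> (T ||| 0) \<inter> ({j} ||| 1) = (insert j S ||| 1) \<inter> (T ||| 0)"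
    "(S ||| 1) \<inter> (T ||| 0) \<inter> ({j} ||| 0) = (S ||| 1) \<inter> (insert j T ||| 0)"
    by (auto simp: fixed_def)
  with ST assms(2) show "(S ||| 1) \<inter> (T ||| 0) \<inter> ({j} ||| 1) \<in> faces (Suc k)"
    "(S ||| 1) \<inter> (T ||| 0) \<inter> ({j} ||| 0) \<in> faces (Suc k)"
    by (auto intro!: facesI)
qed

text \<open>Induction on the number of fractional coordinates: rounding one of them down and up
  gives two points with fewer, and the original point lies on the segment between them.\<close>

lemma mem_convex_hull_face:
  fixes x :: "real^'n::finite"
  assumes "x \<in> cbox 0 1" "\<And>i. i \<in> S \<Longrightarrow> x $ i = 1" "\<And>i. i \<in> T \<Longrightarrow> x $ i = 0"
  shows "x \<in> convex hull ((S ||| 1) \<inter> (T ||| 0))"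
  using assms
proof (induction "card {i. x $ i \<notin> {0, 1}}" arbitrary: x rule: less_induct)
  case less
  show ?case
  proof (cases "\<exists>i. x $ i \<notin> {0, 1}")
    case False
    with less.prems have "x \<in> (S ||| 1) \<inter> (T ||| 0)"
      by (auto simp: fixed_def binaries_def)
    then show ?thesis by (rule hull_inc)
  next
    case True
    then obtain i where i: "x $ i \<notin> {0, 1}" by blast
    \<comment> \<open>The fractional index \<open>i\<close> lies outside
      \<open>S \<union> T\<close>, so changing it keeps the prescribed values. The weights
      \<open>1 - x $ i\<close> and \<open>x $ i\<close> recover \<open>x\<close>.\<close>
    define y where "y c = (\<chi> j. if j = i then c else x $ j)" for c
    have x01: "0 \<le> x $ j" "x $ j \<le> 1" for j
      using less.prems(1) by (auto simp: mem_box_cart)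
    have "y c \<in> convex hull ((S ||| 1) \<inter> (T ||| 0))" if c: "c \<in> {0, 1}" for c
    proof (rule less.hyps)
      have "{j. y c $ j \<notin> {0, 1}} \<subset> {j. x $ j \<notin> {0, 1}}"
        using c i by (auto simp: y_def)
      then show "card {j. y c $ j \<notin> {0, 1}} < card {j. x $ j \<notin> {0, 1}}"
        by (intro psubset_card_mono) auto
    qed (use c i x01 less.prems in \<open>auto simp: y_def mem_box_cart\<close>)
    then have "(1 - x $ i) *\<^sub>R y 0 + (x $ i) *\<^sub>R y 1 \<in> convex hull ((S ||| 1) \<inter> (T ||| 0))"
      using x01[of i] by (intro convexD[OF convex_convex_hull]) auto
    also have "(1 - x $ i) *\<^sub>R y 0 + (x $ i) *\<^sub>R y 1 = x"
      by (auto simp: vec_eq_iff y_def algebra_simps)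
    finally show ?thesis .
  qed
qed

lemma SA_lift_disjoint:
  "Y \<in> SA_lift k P \<Longrightarrow> \<alpha> \<in> faces_pos 1 \<Longrightarrow> \<beta> \<in> faces k \<Longrightarrow> \<alpha> \<inter> \<beta> = {} \<Longrightarrow> Y (\<alpha>, \<beta>) = 0"
  unfolding SA_lift_def by blast

lemma SA_lift_Int_eq:
  "Y \<in> SA_lift k P \<Longrightarrow> \<alpha> \<in> faces_pos 1 \<Longrightarrow> \<alpha>' \<in> faces_pos 1 \<Longrightarrow> \<beta> \<in> faces k \<Longrightarrow> \<beta>' \<in> faces k \<Longrightarrow>
    \<alpha> \<inter> \<beta> = \<alpha>' \<inter> \<beta>' \<Longrightarrow> Y (\<alpha>, \<beta>) = Y (\<alpha>', \<beta>')"
  unfolding SA_lift_def by blast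

lemma SA_lift_col_in_cone: "Y \<in> SA_lift k P \<Longrightarrow> \<beta> \<in> faces k \<Longrightarrow> col Y \<beta> \<in> cone_of P"
  by (simp add: SA_lift_def)

lemma SA_lift_split:
  "Y \<in> SA_lift k P \<Longrightarrow> (S ||| 1) \<inter> (T ||| 0) \<in> faces (k - 1) \<Longrightarrow> j \<notin> S \<union> T \<Longrightarrow>
    col Y ((S ||| 1) \<inter> (T ||| 0) \<inter> ({j} ||| 1)) + col Y ((S ||| 1) \<inter> (T ||| 0) \<inter> ({j} ||| 0)) =
    col Y ((S ||| 1) \<inter> (T ||| 0))"
  by (simp add: SA_lift_def)

lemma col_restrict:
  "\<beta> \<in> faces k \<Longrightarrow> col (restrict Y (faces_pos 1 \<times> faces k)) \<beta> = col Y \<beta>"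
  by (simp add: col_def binaries_in_faces_pos singleton_in_faces_pos del: One_nat_def)

lemma SA_lift_nonzero_imp_meets:
  fixes P :: "(real^'n::finite) set"
  assumes P: "P \<subseteq> cbox 0 1" and Y: "Y \<in> SA_lift k P"
    and disj: "S \<inter> T = {}" and card: "card S + card T \<le> k"
    and nz: "Y (binaries, (S ||| 1) \<inter> (T ||| 0)) \<noteq> 0"
  shows "convex hull ((S ||| 1) \<inter> (T ||| 0)) \<inter> P \<noteq> {}"
proof -
  define \<gamma> :: "(real^'n) set" where "\<gamma> = (S ||| 1) \<inter> (T ||| 0)"
  have \<gamma>: "\<gamma> \<in> faces k" unfolding \<gamma>_def using disj card by (rule facesI)
  obtain c x where x: "x \<in> P" and "col Y \<gamma> = (c, c *\<^sub>R x)"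
    using SA_lift_col_in_cone[OF Y \<gamma>] by (auto simp: cone_of_def)
  then have c: "Y (binaries, \<gamma>) = c" and row: "\<And>i. Y ({i} ||| 1, \<gamma>) = c * x $ i"
    by (auto simp: col_def vec_eq_iff)
  from nz c have "c \<noteq> 0" by (simp add: \<gamma>_def)
  have "x $ i = 1" if "i \<in> S" for i
  proof -
    \<comment> \<open>Since \<gamma> is contained in \<open>{i} ||| 1\<close>, both rows meet it in
      \<gamma> itself, and (5) applies.\<close>
    have "Y ({i} ||| 1, \<gamma>) = Y (binaries, \<gamma>)"
      using that
      by (intro SA_lift_Int_eq[OF Y singleton_in_faces_pos binaries_in_faces_pos \<gamma> \<gamma>])
        (auto simp: \<gamma>_def fixed_def)
    with row c \<open>c \<noteq> 0\<close> show ?thesis by simp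
  qed
  moreover have "x $ i = 0" if "i \<in> T" for i
  proof -
    \<comment> \<open>Here \<gamma> is contained in \<open>{i} ||| 0\<close>, hence disjoint from
      \<open>{i} ||| 1\<close>, and (4) applies.\<close>
    have "Y ({i} ||| 1, \<gamma>) = 0"
      using that
      by (intro SA_lift_disjoint[OF Y singleton_in_faces_pos \<gamma>]) (auto simp: \<gamma>_def fixed_def)
    with row \<open>c \<noteq> 0\<close> show ?thesis by simp
  qed
  ultimately have "x \<in> convex hull ((S ||| 1) \<inter> (T ||| 0))"
    using x P by (intro mem_convex_hull_face) auto
  with x show ?thesis by blast
qed

text \<open>Each condition at level \<open>k\<close> is an instance of the one at level
  \<open>Suc k\<close>. Only (3) needs care, because it mentions columns of split faces, which have
  to stay inside the smaller index set.\<close>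

lemma SA_lift_restrict:
  fixes P :: "(real^'n::finite) set"
  assumes Y: "Y \<in> SA_lift (Suc k) P" and k: "k \<ge> 1"
  shows "restrict Y (faces_pos 1 \<times> faces k) \<in> SA_lift k P"
proof -
  define Z where "Z = restrict Y (faces_pos 1 \<times> faces k)"
  have Z: "Z (\<alpha>, \<beta>) = Y (\<alpha>, \<beta>)" if "\<alpha> \<in> faces_pos 1" "\<beta> \<in> faces k" for \<alpha> \<beta>
    using that by (simp add: Z_def)
  have col: "col Z \<beta> = col Y \<beta>" if "\<beta> \<in> faces k" for \<beta>
    unfolding Z_def using that by (rule col_restrict)
  have mono: "\<beta> \<in> faces (Suc k)" if "\<beta> \<in> faces k" for \<beta> :: "(real^'n) set"
    using that faces_mono[of k "Suc k"] by auto
  have split: "col Z ((S ||| 1) \<inter> (T ||| 0) \<inter> ({j} ||| 1)) +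
           col Z ((S ||| 1) \<inter> (T ||| 0) \<inter> ({j} ||| 0)) = col Z ((S ||| 1) \<inter> (T ||| 0))"
    if ST: "(S ||| 1) \<inter> (T ||| 0) \<in> faces (k - 1)" and j: "j \<in> - (S \<union> T)" for S T j
  proof -
    have face: "(S ||| 1) \<inter> (T ||| 0) \<in> faces k"
      using ST faces_mono[of "k - 1" k] by auto
    have "col Y ((S ||| 1) \<inter> (T ||| 0) \<inter> ({j} ||| 1)) +
           col Y ((S ||| 1) \<inter> (T ||| 0) \<inter> ({j} ||| 0)) = col Y ((S ||| 1) \<inter> (T ||| 0))"
      using SA_lift_split[OF Y, of S T j] face j by simp
    moreover have "(S ||| 1) \<inter> (T ||| 0) \<inter> ({j} ||| 1) \<in> faces k"
        "(S ||| 1) \<inter> (T ||| 0) \<inter> ({j} ||| 0) \<in> faces k"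
      \<comment> \<open>As \<open>k \<ge> 1\<close>, splitting a face of level \<open>k - 1\<close>
        leads to level \<open>Suc (k - 1) = k\<close>.\<close>
      using split_face_in_faces[OF ST] j k by auto
    ultimately show ?thesis using face by (simp add: col)
  qed
  have one: "Z (binaries, binaries) = 1"
    using Y by (simp add: Z binaries_in_faces binaries_in_faces_pos SA_lift_def)
  have cone: "col Z \<beta> \<in> cone_of P" if "\<beta> \<in> faces k" for \<beta>
    using SA_lift_col_in_cone[OF Y mono[OF that]] that by (simp add: col)
  have disjoint: "Z (\<alpha>, \<beta>) = 0"
    if "\<alpha> \<in> faces_pos 1" "\<beta> \<in> faces k" "\<alpha> \<inter> \<beta> = {}" for \<alpha> \<beta>
    using SA_lift_disjoint[OF Y] that by (simp add: Z mono)
  have Int_eq: "Z (\<alpha>, \<beta>) = Z (\<alpha>', \<beta>')"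
    if "\<alpha> \<in> faces_pos 1" "\<alpha>' \<in> faces_pos 1" "\<beta> \<in> faces k" "\<beta>' \<in> faces k" "\<alpha> \<inter> \<beta> = \<alpha>' \<inter> \<beta>'"
    for \<alpha> \<alpha>' \<beta> \<beta>'
    using SA_lift_Int_eq[OF Y, of \<alpha> \<alpha>' \<beta> \<beta>'] that by (simp add: Z mono)
  have extensional: "Z \<in> (faces_pos 1 \<times> faces k) \<rightarrow>\<^sub>E UNIV"
    by (simp add: Z_def)
  have "Z \<in> SA_lift k P"
    unfolding SA_lift_def
  proof (intro CollectI conjI ballI allI impI)
  qed (fact extensional one | erule (1) split | erule cone | erule (2) disjoint | erule (4) Int_eq)+
  then show ?thesis by (simp add: Z_def)
qed

text \<open>The extra level is spent here: \<alpha> may fix one coordinate that \<beta> leaves free,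
  so their intersection may need level \<open>Suc k\<close>.\<close>

lemma SA_lift_zero_of_hulls_disjoint:
  fixes P :: "(real^'n::finite) set"
  assumes P: "P \<subseteq> cbox 0 1" and Y: "Y \<in> SA_lift (Suc k) P"
    and \<alpha>: "\<alpha> \<in> faces_pos 1" and \<beta>: "\<beta> \<in> faces k"
    and empty: "convex hull \<alpha> \<inter> convex hull \<beta> \<inter> P = {}"
  shows "Y (\<alpha>, \<beta>) = 0"
proof (rule ccontr)
  assume nz: "Y (\<alpha>, \<beta>) \<noteq> 0"
  have \<beta>': "\<beta> \<in> faces (Suc k)"
    using \<beta> faces_mono[of k "Suc k"] by auto
  have ne: "\<alpha> \<inter> \<beta> \<noteq> {}"
    using SA_lift_disjoint[OF Y \<alpha> \<beta>'] nz by blast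
  obtain R where R: "\<alpha> = R ||| 1" "card R \<le> 1"
    using \<alpha> by (auto simp: faces_pos_def)
  obtain S T where ST: "\<beta> = (S ||| 1) \<inter> (T ||| 0)" "S \<inter> T = {}" "card S + card T \<le> k"
    using \<beta> by (auto simp: faces_def)
  have \<gamma>: "\<alpha> \<inter> \<beta> = ((R \<union> S) ||| 1) \<inter> (T ||| 0)"
    unfolding R ST using fixed_Int[of R 1 S] by auto
  \<comment> \<open>A common index would have to take both values 1 and 0, leaving the intersection
    empty.\<close>
  have disj: "(R \<union> S) \<inter> T = {}"
    using ne unfolding \<gamma> by (force simp: fixed_def)
  have card: "card (R \<union> S) + card T \<le> Suc k"
    using card_Un_le[of R S] R ST by linarith
  have "\<alpha> \<inter> \<beta> \<in> faces (Suc k)"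
    unfolding \<gamma> using disj card by (rule facesI)
  then have "Y (binaries, \<alpha> \<inter> \<beta>) = Y (\<alpha>, \<beta>)"
    using face_subset_binaries[OF \<beta>]
    by (intro SA_lift_Int_eq[OF Y binaries_in_faces_pos \<alpha> _ \<beta>']) auto
  with nz have "convex hull (\<alpha> \<inter> \<beta>) \<inter> P \<noteq> {}"
    using SA_lift_nonzero_imp_meets[OF P Y disj card] by (simp add: \<gamma>)
  moreover have "convex hull (\<alpha> \<inter> \<beta>) \<subseteq> convex hull \<alpha> \<inter> convex hull \<beta>"
    by (simp add: hull_mono)
  ultimately show False using empty by blast
qed

theorem proposition2:
  fixes P :: "(real^'n) set" and k :: nat
  assumes "P \<subseteq> cbox 0 1" and "k \<ge> 1"
  shows "SA (k + 1) P \<subseteq> SA' k P"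
proof
  fix x assume "x \<in> SA (k + 1) P"
  then obtain Y where Y: "Y \<in> SA_lift (Suc k) P" and x: "col Y binaries = (1, x)"
    by (auto simp: SA_def)
  \<comment> \<open>Members of \<open>SA_lift k P\<close> are undefined off their index set, so
    \<open>Y\<close> itself need not be one.\<close>
  define Z where "Z = restrict Y (faces_pos 1 \<times> faces k)"
  have "Z \<in> SA'_lift k P"
    using SA_lift_restrict[OF Y assms(2)] SA_lift_zero_of_hulls_disjoint[OF assms(1) Y]
    by (auto simp: SA'_lift_def Z_def)
  moreover have "col Z binaries = (1, x)"
    using x unfolding Z_def by (simp only: col_restrict[OF binaries_in_faces])
  ultimately show "x \<in> SA' k P" by (auto simp: SA'_def)
qed

end
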